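(* Let $G=(V,E)$ be a finite connected graph with at least two vertices, and let $F_0\subseteq F_1\subseteq F_2\subseteq\cdots\subseteq V\times V$ be the sets of pairs defined recursively in the context. If $(x,y)$ belongs to $\bigcup_{i=0}^{\infty}F_i$, then $(x,y)$ is a forbidden state for $G$.
   Context: Here $x\sim y$ means adjacent, $N(x)$ is the set of neighbors of $x$, and $d(x)=|N(x)|$. A simple random walk on $G$ moves from $v$ to each neighbor with probability $1/d(v)$. A Markovian avoidance process of two tokens $X,Y$ on $V$ is a (time-homogeneous) Markov chain on $V\times V$ with transition probabilities $T[(x,y)\rightarrow(x',y')]$ and stationary distribution $s$, such that $s(v,v)=0$ for all $v\in V$, and whenever $s(v,w)>0$ one has $T[(v,w)\rightarrow(w,u)]=0$ for all $u\in V$. A uniform avoidance coupling of two simple random walks on $G$ is a Markovian avoidance process such that for every state $(x,y)$ with $s(x,y)>0$: $\sum_{y'}T[(x,y)\rightarrow(x',y')]$ equals $1/d(x)$ if $x'\sim x$ and $0$ otherwise, and $\sum_{x'}T[(x,y)\rightarrow(x',y')]$ equals $1/d(y)$ if $y'\sim y$ and $0$ otherwise. A forbidden state for $G$ is a pair $(x,y)\in V\times V$ such that there is no uniform avoidance coupling of two simple random walks on $G$ in which $(x,y)$ has non-zero stationary probability. Recursive definition: $F_0=\{(x,y)\in V\times V: x\sim y\}$. Given $F_i$, the set $F_{i+1}$ consists of all elements of $F_i$ together with all $(x,y)\notin F_i$ that fail the following test. Form the bipartite graph with left side $N(x)$ and right side $N(y)$ (a common neighbor of $x$ and $y$ has one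 copy on each side), with an arc from $x'\in N(x)$ to $y'\in N(y)$ if and only if $x'\ne y'$ and $(x',y')\notin F_i$. The pair $(x,y)$ passes the test if and only if there is a nonnegative flow on the arcs such that each left node sends out total $1/d(x)$ and each right node receives total $1/d(y)$. (When $d(y)\ge d(x)$ this is equivalent to: every $A\subseteq N(x)$ has at least $|A|\,d(y)/d(x)$ out-neighbors on the right side.) *)

theory Defs
  imports
    "HOL-Probability.Probability_Mass_Function"
    "Graph_Theory.Digraph"
    "Graph_Theory.Digraph_Component"
begin

text \<open>A finite simple graph is an instance of the locale \<^locale>\<open>graph\<close>: undirected edges are
  symmetric pairs of arcs, so adjacency is the relation \<open>v \<rightarrow>\<^bsub>G\<^esub> w\<close>.\<close>

definition nbrs :: "('a, 'b) pre_digraph \<Rightarrow> 'a \<Rightarrow> 'a set" where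
  "nbrs G v = {w \<in> verts G. v \<rightarrow>\<^bsub>G\<^esub> w}"

definition deg :: "('a, 'b) pre_digraph \<Rightarrow> 'a \<Rightarrow> nat" where
  "deg G v = card (nbrs G v)"

text \<open>A Markov chain on a state set \<open>S\<close> is given by its transition kernel; the transition
  probability from \<open>z\<close> to \<open>z'\<close> is \<open>pmf (T z) z'\<close>. The values of \<open>T\<close> outside \<open>S\<close> are irrelevant.\<close>

definition markov_kernel_on :: "'s set \<Rightarrow> ('s \<Rightarrow> 's pmf) \<Rightarrow> bool" where
  "markov_kernel_on S T \<longleftrightarrow> (\<forall>z\<in>S. set_pmf (T z) \<subseteq> S)"

definition stationary_on :: "'s set \<Rightarrow> ('s \<Rightarrow> 's pmf) \<Rightarrow> 's pmf \<Rightarrow> bool" where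
  "stationary_on S T s \<longleftrightarrow> set_pmf s \<subseteq> S \<and> bind_pmf s T = s"

definition markovian_avoidance_process ::
  "'a set \<Rightarrow> ('a \<times> 'a \<Rightarrow> ('a \<times> 'a) pmf) \<Rightarrow> ('a \<times> 'a) pmf \<Rightarrow> bool" where
  "markovian_avoidance_process V T s \<longleftrightarrow>
     markov_kernel_on (V \<times> V) T \<and> stationary_on (V \<times> V) T s \<and>
     (\<forall>v\<in>V. pmf s (v, v) = 0) \<and>
     (\<forall>v\<in>V. \<forall>w\<in>V. pmf s (v, w) > 0 \<longrightarrow> (\<forall>u\<in>V. pmf (T (v, w)) (w, u) = 0))"

definition uniform_avoidance_coupling ::
  "('a, 'b) pre_digraph \<Rightarrow> ('a \<times> 'a \<Rightarrow> ('a \<times> 'a) pmf) \<Rightarrow> ('a \<times> 'a) pmf \<Rightarrow> bool" where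
  "uniform_avoidance_coupling G T s \<longleftrightarrow>
     markovian_avoidance_process (verts G) T s \<and>
     (\<forall>x\<in>verts G. \<forall>y\<in>verts G. pmf s (x, y) > 0 \<longrightarrow>
        (\<forall>x'\<in>verts G. (\<Sum>y'\<in>verts G. pmf (T (x, y)) (x', y')) =
                          (if x' \<in> nbrs G x then 1 / real (deg G x) else 0)) \<and>
        (\<forall>y'\<in>verts G. (\<Sum>x'\<in>verts G. pmf (T (x, y)) (x', y')) =
                          (if y' \<in> nbrs G y then 1 / real (deg G y) else 0)))"

definition forbidden_state :: "('a, 'b) pre_digraph \<Rightarrow> 'a \<times> 'a \<Rightarrow> bool" where
  "forbidden_state G z \<longleftrightarrow> z \<in> verts G \<times> verts G \<and>
     \<not> (\<exists>T s. uniform_avoidance_coupling G T s \<and> pmf s z \<noteq> 0)"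

text \<open>Arcs of the bipartite graph: the first component is a left node, the second component a
  right node, so a common neighbour of \<open>x\<close> and \<open>y\<close> has a copy on each side.\<close>

definition test_arcs ::
  "('a, 'b) pre_digraph \<Rightarrow> ('a \<times> 'a) set \<Rightarrow> 'a \<Rightarrow> 'a \<Rightarrow> ('a \<times> 'a) set" where
  "test_arcs G F x y =
     {(x', y'). x' \<in> nbrs G x \<and> y' \<in> nbrs G y \<and> x' \<noteq> y' \<and> (x', y') \<notin> F}"

definition passes_test ::
  "('a, 'b) pre_digraph \<Rightarrow> ('a \<times> 'a) set \<Rightarrow> 'a \<Rightarrow> 'a \<Rightarrow> bool" where
  "passes_test G F x y \<longleftrightarrow>
     (\<exists>f :: 'a \<times> 'a \<Rightarrow> real.
        (\<forall>a \<in> test_arcs G F x y. f a \<ge> 0) \<and>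
        (\<forall>x'\<in>nbrs G x.
           (\<Sum>y' | (x', y') \<in> test_arcs G F x y. f (x', y')) = 1 / real (deg G x)) \<and>
        (\<forall>y'\<in>nbrs G y.
           (\<Sum>x' | (x', y') \<in> test_arcs G F x y. f (x', y')) = 1 / real (deg G y)))"

primrec forb :: "('a, 'b) pre_digraph \<Rightarrow> nat \<Rightarrow> ('a \<times> 'a) set" where
  "forb G 0 = {(x, y) \<in> verts G \<times> verts G. x \<rightarrow>\<^bsub>G\<^esub> y}"
| "forb G (Suc i) = forb G i \<union>
     {(x, y) \<in> verts G \<times> verts G. (x, y) \<notin> forb G i \<and> \<not> passes_test G (forb G i) x y}"

end

theory Submission
  imports Defs
begin

text \<open>Only the support \<open>S\<close> of the stationary distribution matters. It is closed under the
  transitions of the chain, so each \<open>(x, y) \<in> S\<close> admits a coupling of one step of the two walks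
  whose support lies in \<open>S\<close>. If \<open>S\<close> misses \<open>F\<^sub>i\<close>, this coupling is a flow showing that \<open>(x, y)\<close>
  passes the test, hence \<open>S\<close> misses \<open>F\<^sub>i\<^sub>+\<^sub>1\<close>. It misses \<open>F\<^sub>0\<close> because the first token steps onto
  each neighbour of its position with positive probability, and so onto the second token if the
  two are adjacent.\<close>

lemma pmf_map_fst_eq_sum:
  assumes "finite B" and "\<And>b. (a, b) \<in> set_pmf p \<Longrightarrow> b \<in> B"
  shows "pmf (map_pmf fst p) a = (\<Sum>b\<in>B. pmf p (a, b))"
proof -
  have "pmf (map_pmf fst p) a = measure p (fst -` {a})"
    by (rule pmf_map)
  also have "\<dots> = measure p (Pair a ` B)"
    using assms(2) by (intro measure_prob_cong_0) (auto simp: set_pmf_iff)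
  also have "\<dots> = (\<Sum>b\<in>B. pmf p (a, b))"
    using assms(1) by (simp add: measure_measure_pmf_finite sum.reindex inj_on_def)
  finally show ?thesis .
qed

lemma pmf_map_snd_eq_sum:
  assumes "finite A" and "\<And>a. (a, b) \<in> set_pmf p \<Longrightarrow> a \<in> A"
  shows "pmf (map_pmf snd p) b = (\<Sum>a\<in>A. pmf p (a, b))"
proof -
  have "pmf (map_pmf snd p) b = pmf (map_pmf fst (map_pmf prod.swap p)) b"
    by (simp add: map_pmf_comp)
  also have "\<dots> = (\<Sum>a\<in>A. pmf (map_pmf prod.swap p) (prod.swap (a, b)))"
    using assms by (subst pmf_map_fst_eq_sum[where B = A]) auto
  also have "\<dots> = (\<Sum>a\<in>A. pmf p (a, b))"
    by (simp only: pmf_map_inj'[OF inj_swap])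
  finally show ?thesis .
qed

lemma eq_pmf_of_setI:
  assumes "set_pmf p \<subseteq> A" and "N \<subseteq> A"
    and pmf: "\<And>a. a \<in> A \<Longrightarrow> pmf p a = (if a \<in> N then 1 / real (card N) else 0)"
  shows "N \<noteq> {}" and "finite N" and "p = pmf_of_set N"
proof -
  have pmf_p: "pmf p a = (if a \<in> N then 1 / real (card N) else 0)" for a
    using assms by (cases "a \<in> A") (auto simp: set_pmf_iff)
  obtain a where "a \<in> set_pmf p"
    using set_pmf_not_empty by fast
  then have "card N \<noteq> 0"
    using pmf_p[of a] by (auto simp: set_pmf_iff split: if_splits)
  then show "N \<noteq> {}" and "finite N"
    by (simp_all add: card_eq_0_iff)
  then show "p = pmf_of_set N"
    by (intro pmf_eqI) (simp add: pmf_p)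
qed

lemma stationary_on_support_closed:
  assumes "stationary_on S T s" and "z \<in> set_pmf s"
  shows "set_pmf (T z) \<subseteq> set_pmf s"
proof -
  have "set_pmf (bind_pmf s T) = set_pmf s"
    using assms(1) by (simp add: stationary_on_def)
  with assms(2) show ?thesis
    unfolding set_bind_pmf by blast
qed

lemma nbrs_subset_verts: "nbrs G v \<subseteq> verts G"
  by (auto simp: nbrs_def)

lemma finite_nbrs: "finite (verts G) \<Longrightarrow> finite (nbrs G v)"
  using nbrs_subset_verts by (rule finite_subset)

lemma forb_subset_verts: "forb G i \<subseteq> verts G \<times> verts G"
  by (induction i) auto

text \<open>The non-emptiness assumption excludes isolated vertices, for which \<^term>\<open>pmf_of_set\<close> is a
  junk value.\<close>

definition avoidance_closed :: "('a, 'b) pre_digraph \<Rightarrow> ('a \<times> 'a) set \<Rightarrow> bool" where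
  "avoidance_closed G S \<longleftrightarrow>
     (\<forall>(x, y)\<in>S. x \<noteq> y \<and> \<not> x \<rightarrow>\<^bsub>G\<^esub> y \<and> nbrs G x \<noteq> {} \<and> nbrs G y \<noteq> {} \<and>
        rel_pmf (\<lambda>x' y'. (x', y') \<in> S) (pmf_of_set (nbrs G x)) (pmf_of_set (nbrs G y)))"

lemma passes_test_if_rel_pmf:
  assumes fin: "finite (nbrs G x)" "finite (nbrs G y)"
    and nonempty: "nbrs G x \<noteq> {}" "nbrs G y \<noteq> {}"
    and rel: "rel_pmf (\<lambda>x' y'. x' \<noteq> y' \<and> (x', y') \<notin> F)
      (pmf_of_set (nbrs G x)) (pmf_of_set (nbrs G y))"
  shows "passes_test G F x y"
proof -
  let ?A = "test_arcs G F x y"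
  obtain p where off_F: "\<And>x' y'. (x', y') \<in> set_pmf p \<Longrightarrow> x' \<noteq> y' \<and> (x', y') \<notin> F"
    and fst: "map_pmf fst p = pmf_of_set (nbrs G x)"
    and snd: "map_pmf snd p = pmf_of_set (nbrs G y)"
    using rel by cases blast
  have "fst ` set_pmf p = nbrs G x" "snd ` set_pmf p = nbrs G y"
    using fin nonempty by (simp_all flip: set_map_pmf add: fst snd)
  then have supp: "set_pmf p \<subseteq> ?A"
    using off_F by (force simp: test_arcs_def)
  have outflow: "(\<Sum>y' | (x', y') \<in> ?A. pmf p (x', y')) = 1 / real (deg G x)"
    if "x' \<in> nbrs G x" for x'
  proof -
    have "finite {y'. (x', y') \<in> ?A}"
      using fin(2) by (rule rev_finite_subset) (auto simp: test_arcs_def)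
    then have "(\<Sum>y' | (x', y') \<in> ?A. pmf p (x', y')) = pmf (map_pmf fst p) x'"
      using supp by (intro pmf_map_fst_eq_sum[symmetric]) auto
    then show ?thesis
      using that fin nonempty by (simp add: fst deg_def)
  qed
  have inflow: "(\<Sum>x' | (x', y') \<in> ?A. pmf p (x', y')) = 1 / real (deg G y)"
    if "y' \<in> nbrs G y" for y'
  proof -
    have "finite {x'. (x', y') \<in> ?A}"
      using fin(1) by (rule rev_finite_subset) (auto simp: test_arcs_def)
    then have "(\<Sum>x' | (x', y') \<in> ?A. pmf p (x', y')) = pmf (map_pmf snd p) y'"
      using supp by (intro pmf_map_snd_eq_sum[symmetric]) auto
    then show ?thesis
      using that fin nonempty by (simp add: snd deg_def)
  qed
  show ?thesis
    unfolding passes_test_def using outflow inflow by (intro exI[of _ "pmf p"]) simp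
qed

lemma avoidance_closed_disjoint_forb:
  assumes "finite (verts G)" and closed: "avoidance_closed G S"
  shows "S \<inter> forb G i = {}"
proof (induction i)
  case 0
  then show ?case
    using closed by (auto simp: avoidance_closed_def)
next
  case (Suc i)
  have "passes_test G (forb G i) x y" if "(x, y) \<in> S" for x y
  proof (rule passes_test_if_rel_pmf)
    have "rel_pmf (\<lambda>x' y'. (x', y') \<in> S) (pmf_of_set (nbrs G x)) (pmf_of_set (nbrs G y))"
      using closed that by (auto simp: avoidance_closed_def)
    then show "rel_pmf (\<lambda>x' y'. x' \<noteq> y' \<and> (x', y') \<notin> forb G i)
        (pmf_of_set (nbrs G x)) (pmf_of_set (nbrs G y))"
      by (rule pmf.rel_mono_strong) (use closed Suc.IH in \<open>auto simp: avoidance_closed_def\<close>)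
    show "nbrs G x \<noteq> {}" "nbrs G y \<noteq> {}"
      using closed that by (auto simp: avoidance_closed_def)
  qed (use assms(1) in \<open>simp_all add: finite_nbrs\<close>)
  with Suc.IH show ?case
    by auto
qed

lemma uniform_avoidance_coupling_in_verts:
  assumes coupling: "uniform_avoidance_coupling G T s" and state: "(x, y) \<in> set_pmf s"
  shows "x \<in> verts G" and "y \<in> verts G" and "set_pmf (T (x, y)) \<subseteq> verts G \<times> verts G"
proof -
  have process: "markovian_avoidance_process (verts G) T s"
    using coupling by (simp add: uniform_avoidance_coupling_def)
  then show verts: "x \<in> verts G" "y \<in> verts G"
    using state by (auto simp: markovian_avoidance_process_def stationary_on_def)
  show "set_pmf (T (x, y)) \<subseteq> verts G \<times> verts G"
    using process verts by (simp add: markovian_avoidance_process_def markov_kernel_on_def)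
qed

lemma uniform_avoidance_coupling_marginals:
  assumes fin: "finite (verts G)" and coupling: "uniform_avoidance_coupling G T s"
    and state: "(x, y) \<in> set_pmf s"
  shows "nbrs G x \<noteq> {}" and "map_pmf fst (T (x, y)) = pmf_of_set (nbrs G x)"
    and "nbrs G y \<noteq> {}" and "map_pmf snd (T (x, y)) = pmf_of_set (nbrs G y)"
proof -
  note verts = uniform_avoidance_coupling_in_verts[OF coupling state]
  have set_fst: "set_pmf (map_pmf fst (T (x, y))) \<subseteq> verts G"
    using verts(3) by auto
  have pmf_fst: "pmf (map_pmf fst (T (x, y))) x' =
      (if x' \<in> nbrs G x then 1 / real (card (nbrs G x)) else 0)" if "x' \<in> verts G" for x'
    using coupling verts pmf_positive[OF state] that
    by (subst pmf_map_fst_eq_sum[OF fin]) (auto simp: uniform_avoidance_coupling_def deg_def)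
  show "nbrs G x \<noteq> {}"
    using set_fst nbrs_subset_verts pmf_fst by (rule eq_pmf_of_setI)
  show "map_pmf fst (T (x, y)) = pmf_of_set (nbrs G x)"
    using set_fst nbrs_subset_verts pmf_fst by (rule eq_pmf_of_setI)
  have set_snd: "set_pmf (map_pmf snd (T (x, y))) \<subseteq> verts G"
    using verts(3) by auto
  have pmf_snd: "pmf (map_pmf snd (T (x, y))) y' =
      (if y' \<in> nbrs G y then 1 / real (card (nbrs G y)) else 0)" if "y' \<in> verts G" for y'
    using coupling verts pmf_positive[OF state] that
    by (subst pmf_map_snd_eq_sum[OF fin]) (auto simp: uniform_avoidance_coupling_def deg_def)
  show "nbrs G y \<noteq> {}"
    using set_snd nbrs_subset_verts pmf_snd by (rule eq_pmf_of_setI)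
  show "map_pmf snd (T (x, y)) = pmf_of_set (nbrs G y)"
    using set_snd nbrs_subset_verts pmf_snd by (rule eq_pmf_of_setI)
qed

lemma uniform_avoidance_coupling_off_diagonal:
  assumes coupling: "uniform_avoidance_coupling G T s" and state: "(x, y) \<in> set_pmf s"
  shows "x \<noteq> y"
  using coupling state uniform_avoidance_coupling_in_verts[OF coupling state]
  by (auto simp: uniform_avoidance_coupling_def markovian_avoidance_process_def set_pmf_iff)

lemma uniform_avoidance_coupling_not_adjacent:
  assumes fin: "finite (verts G)" and coupling: "uniform_avoidance_coupling G T s"
    and state: "(x, y) \<in> set_pmf s"
  shows "\<not> x \<rightarrow>\<^bsub>G\<^esub> y"
proof
  assume "x \<rightarrow>\<^bsub>G\<^esub> y"
  note verts = uniform_avoidance_coupling_in_verts[OF coupling state]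
    and marginals = uniform_avoidance_coupling_marginals[OF fin coupling state]
  have "y \<in> nbrs G x"
    using \<open>x \<rightarrow>\<^bsub>G\<^esub> y\<close> verts by (simp add: nbrs_def)
  also have "nbrs G x = fst ` set_pmf (T (x, y))"
    using marginals(1) finite_nbrs[OF fin] by (simp flip: set_map_pmf add: marginals(2))
  finally obtain u where u: "(y, u) \<in> set_pmf (T (x, y))"
    by auto
  then have "u \<in> verts G"
    using verts by blast
  then have "pmf (T (x, y)) (y, u) = 0"
    using coupling verts pmf_positive[OF state]
    by (simp add: uniform_avoidance_coupling_def markovian_avoidance_process_def)
  with u show False
    by (simp add: set_pmf_iff)
qed

lemma avoidance_closed_support:
  assumes fin: "finite (verts G)" and coupling: "uniform_avoidance_coupling G T s"
  shows "avoidance_closed G (set_pmf s)"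
proof -
  have stationary: "stationary_on (verts G \<times> verts G) T s"
    using coupling
    by (simp add: uniform_avoidance_coupling_def markovian_avoidance_process_def)
  have "rel_pmf (\<lambda>x' y'. (x', y') \<in> set_pmf s) (pmf_of_set (nbrs G x)) (pmf_of_set (nbrs G y))"
    if "(x, y) \<in> set_pmf s" for x y
    using uniform_avoidance_coupling_marginals(2,4)[OF fin coupling that]
      stationary_on_support_closed[OF stationary that]
    by (intro rel_pmf.intros[of "T (x, y)"]) auto
  then show ?thesis
    using uniform_avoidance_coupling_off_diagonal[OF coupling]
      uniform_avoidance_coupling_not_adjacent[OF fin coupling]
      uniform_avoidance_coupling_marginals(1,3)[OF fin coupling]
    by (auto simp: avoidance_closed_def)
qed

theorem theorem7p4:
  fixes G :: "('a, 'b) pre_digraph" and x y :: 'a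
  assumes "graph G"
    and "Digraph_Component.connected G"
    and "card (verts G) \<ge> 2"
    and "(x, y) \<in> (\<Union>i. forb G i)"
  shows "forbidden_state G (x, y)"
proof -
  interpret graph G by fact
  obtain i where i: "(x, y) \<in> forb G i"
    using assms(4) by blast
  have "pmf s (x, y) = 0" if coupling: "uniform_avoidance_coupling G T s" for T s
  proof -
    have "set_pmf s \<inter> forb G i = {}"
      using finite_verts avoidance_closed_support[OF finite_verts coupling]
      by (rule avoidance_closed_disjoint_forb)
    with i show ?thesis
      by (auto simp: set_pmf_iff)
  qed
  moreover have "(x, y) \<in> verts G \<times> verts G"
    using i forb_subset_verts by blast
  ultimately show ?thesis
    unfolding forbidden_state_def by blast
qed

end
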